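(* Let $k,w,s\in\mathbb Z_{>0}$. The following identities hold: \begin{align*} N_k^{(w,s)}(z;q,t)&=N_k^{(s,w)}(z;t,q),\\ N_k^{(w,s)}(z;q,t)&=(-1)^{wsk}z^{wsk}N_k^{(w,s)}(z^{-1};q,t),\\ N_k^{(w,s)}(z;q^{-1},t^{-1})&=N_k^{(w,s)}(z;q,t). \end{align*}
   Context: $q,t,z$ are independent indeterminates. For $m\in\mathbb Z_{>0}$, $I_m=\left\{r-\frac{m-1}{2}:r\in\mathbb Z,\ 0\le r<m\right\}$. For $k,w,s\in\mathbb Z_{>0}$, the centered product is \[ N_k^{(w,s)}(z;q,t)=\prod_{(r,i,j)\in I_k\times I_s\times I_w}\bigl(1-zq^{j+wr}t^{i+sr}\bigr)\in\mathbb Z[q^{\pm\frac12},t^{\pm\frac12}][z]. \] Thus $N_k^{(s,w)}(z;t,q)$ is obtained by interchanging $w$ with $s$ and $q$ with $t$ in this definition, and $N_k^{(w,s)}(z;q^{-1},t^{-1})$ by replacing $q^{1/2},t^{1/2}$ with their inverses. *)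

theory Defs
  imports Complex_Main
    "HOL-Library.Poly_Mapping" "HOL-Library.Product_Plus"
    "HOL-Computational_Algebra.Polynomial"
begin

text \<open>
  The coefficient ring $\mathbb{Z}[q^{\pm 1/2}, t^{\pm 1/2}]$ is the group ring of
  $\mathbb{Z}^2$: the key $(a, b)$ stands for the monomial $q^{a/2} t^{b/2}$, and the
  multiplication of finitely supported functions is the convolution product.
\<close>

type_synonym qt_laurent = "(int \<times> int) \<Rightarrow>\<^sub>0 int"

text \<open>
  The monomial $q^x t^y$. It is only meaningful for half-integers $x$ and $y$, where the
  floors are exact.
\<close>

definition qt_mon :: "rat \<Rightarrow> rat \<Rightarrow> qt_laurent" where
  "qt_mon x y = Poly_Mapping.single (\<lfloor>2 * x\<rfloor>, \<lfloor>2 * y\<rfloor>) 1"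

definition I :: "nat \<Rightarrow> rat set" where
  "I m = {of_int r - (of_nat m - 1) / 2 | r. 0 \<le> r \<and> r < int m}"

definition N :: "nat \<Rightarrow> nat \<Rightarrow> nat \<Rightarrow> qt_laurent poly" where
  "N k w s = (\<Prod>(r, i, j) \<in> I k \<times> I s \<times> I w.
     1 - monom (qt_mon (j + of_nat w * r) (i + of_nat s * r)) 1)"

text \<open>
  The ring automorphisms of $\mathbb{Z}[q^{\pm 1/2}, t^{\pm 1/2}]$ interchanging
  $q^{1/2}$ with $t^{1/2}$, respectively inverting both of them, act by permuting the
  exponents.
\<close>

definition swap_qt :: "qt_laurent \<Rightarrow> qt_laurent" where
  "swap_qt = Poly_Mapping.map_key prod.swap"

definition inv_qt :: "qt_laurent \<Rightarrow> qt_laurent" where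
  "inv_qt = Poly_Mapping.map_key uminus"

text \<open>
  The Laurent polynomials in $z$ over $\mathbb{Z}[q^{\pm 1/2}, t^{\pm 1/2}]$, in which
  both $z$ and $z^{-1}$ can be substituted into a polynomial in $z$.
\<close>

type_synonym qtz_laurent = "int \<Rightarrow>\<^sub>0 qt_laurent"

definition z_pow :: "int \<Rightarrow> qtz_laurent" where
  "z_pow n = Poly_Mapping.single n 1"

definition subst_z :: "qt_laurent poly \<Rightarrow> qtz_laurent \<Rightarrow> qtz_laurent" where
  "subst_z p u = poly (map_poly (Poly_Mapping.single 0) p) u"

text \<open>The index sets are finite, and all exponents occurring in \<open>N\<close> are half-integers.\<close>

lemma I_eq_image: "I m = (\<lambda>r. of_int r - (of_nat m - 1) / 2) ` {0..<int m}"
  by (auto simp: I_def)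

lemma finite_I: "finite (I m)"
  by (simp add: I_eq_image)

lemma I_exponent_half_integer:
  assumes "r \<in> I k" and "j \<in> I w"
  shows "2 * (j + of_nat w * r) \<in> \<int>"
proof -
  obtain a b :: int where r: "r = of_int a - (of_nat k - 1) / 2"
    and j: "j = of_int b - (of_nat w - 1) / 2"
    using assms by (auto simp: I_def)
  have "2 * (j + of_nat w * r) =
      of_int (2 * b - (int w - 1) + int w * (2 * a - (int k - 1)))"
    by (simp add: r j field_simps)
  then show ?thesis by (metis Ints_of_int)
qed

lemma swap_qt_mon: "swap_qt (qt_mon x y) = qt_mon y x"
proof -
  have "Poly_Mapping.single (\<lfloor>2 * x\<rfloor>, \<lfloor>2 * y\<rfloor>) (1::int) =
      Poly_Mapping.single (prod.swap (\<lfloor>2 * y\<rfloor>, \<lfloor>2 * x\<rfloor>)) 1"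
    by simp
  then show ?thesis
    unfolding swap_qt_def qt_mon_def by (simp only: map_key_single inj_swap)
qed

lemma inv_qt_mon:
  assumes "2 * x \<in> \<int>" and "2 * y \<in> \<int>"
  shows "inv_qt (qt_mon x y) = qt_mon (- x) (- y)"
proof -
  obtain a b :: int where ab: "2 * x = of_int a" "2 * y = of_int b"
    using assms by (auto elim!: Ints_cases)
  have m: "2 * - x = of_int (- a)" "2 * - y = of_int (- b)"
    using ab by simp_all
  have "Poly_Mapping.single (a, b) (1::int) = Poly_Mapping.single (- (- a, - b)) 1"
    by simp
  moreover have "inj (uminus :: int \<times> int \<Rightarrow> _)"
    by simp
  ultimately show ?thesis
    unfolding inv_qt_def qt_mon_def ab m floor_of_int by (simp only: map_key_single)
qed

end

theory Submission imports Defs begin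

text \<open>
  Write \<open>N k w s\<close> as the product of the factors \<open>1 - c\<^sub>x z\<close>, where \<open>x = (r, i, j)\<close> runs
  over \<open>I k \<times> I s \<times> I w\<close> and \<open>c\<^sub>x\<close> is the monomial \<open>q\<^sup>a t\<^sup>b\<close> with \<open>a = j + w r\<close> and
  \<open>b = i + s r\<close>. Two symmetries of the index set give the three identities.

  Exchanging \<open>i\<close> with \<open>j\<close> exchanges the exponents of \<open>q\<close> and \<open>t\<close> once \<open>w\<close> and \<open>s\<close> are
  exchanged too (\<open>swap_qt_N\<close>).

  Each \<open>I m\<close> is symmetric about 0, so \<open>x \<mapsto> - x\<close> permutes the index set, and the exponents are
  linear in \<open>x\<close>, so it inverts \<open>c\<^sub>x\<close>. Inverting \<open>q\<close> and \<open>t\<close> therefore only permutes the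
  factors (\<open>inv_qt_N\<close>). For the inversion of \<open>z\<close>, multiply the factor \<open>1 - c\<^sub>x z\<^sup>-\<^sup>1\<close>
  by \<open>- z\<close>: the result is \<open>c\<^sub>x - z\<close>, that is \<open>c\<^sub>x\<close> times the factor at \<open>- x\<close>. Taking the
  product over all \<open>x\<close> leaves the product of the \<open>c\<^sub>x\<close>, which is 1 because the exponents
  cancel in pairs \<open>x, - x\<close> (\<open>prod_factor_mon\<close>, \<open>subst_z_N_inverse\<close>).

  To move substitutions through the product, all of them are treated as ring homomorphisms on
  coefficients. For the two substitutions in \<open>q\<close> and \<open>t\<close> this is the fact that a bijective
  additive map of exponents induces a ring homomorphism of monoid rings
  (\<open>comm_ring_hom_map_key\<close>). A substitution for \<open>z\<close> first embeds the coefficients into the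
  Laurent polynomials in \<open>z\<close> as constants and then evaluates.
\<close>

section \<open>Reindexing the exponents of a monoid ring\<close>

lemma poly_mapping_single_add_induct [case_names zero single add]:
  fixes p :: "'a \<Rightarrow>\<^sub>0 'b::comm_monoid_add"
  assumes "P 0" and single: "\<And>a c. P (Poly_Mapping.single a c)"
    and add: "\<And>p q. P p \<Longrightarrow> P q \<Longrightarrow> P (p + q)"
  shows "P p"
proof (induction p rule: update_induct)
  case const
  show ?case by (rule assms)
next
  case (update p a c)
  then have "Poly_Mapping.update a c p = p + Poly_Mapping.single a c"
    by (intro poly_mapping_eqI)
      (auto simp: lookup_update lookup_add lookup_single in_keys_iff when_def)
  then show ?case
    using add[OF update.IH single] by simp
qed

text \<open>
  By distributivity it suffices to multiply two monomials, whose exponents add; \<open>map_key f\<close>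
  applies the additive map \<open>inv f\<close> to exponents, since it composes coefficient functions with
  \<open>f\<close>.
\<close>

lemma map_key_mult:
  fixes f :: "'a::monoid_add \<Rightarrow> 'b::monoid_add" and p q :: "'b \<Rightarrow>\<^sub>0 'c::semiring_0"
  assumes "bij f" and add: "\<And>a b. f (a + b) = f a + f b"
  shows "Poly_Mapping.map_key f (p * q) = Poly_Mapping.map_key f p * Poly_Mapping.map_key f q"
proof -
  have inj: "inj f"
    using \<open>bij f\<close> by (rule bij_is_inj)
  have single: "Poly_Mapping.map_key f (Poly_Mapping.single a c) = Poly_Mapping.single (inv f a) c"
    for a and c :: 'c
    using map_key_single[OF inj, of "inv f a" c] \<open>bij f\<close> by (simp add: bij_is_surj surj_f_inv_f)
  have inv_add: "inv f (a + b) = inv f a + inv f b" for a b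
    by (rule inv_f_eq[OF inj]) (simp add: add bij_is_surj[OF \<open>bij f\<close>] surj_f_inv_f)
  have single_mult: "Poly_Mapping.map_key f (Poly_Mapping.single a c * q)
      = Poly_Mapping.single (inv f a) c * Poly_Mapping.map_key f q" for a c
    by (induction q rule: poly_mapping_single_add_induct)
      (simp_all add: mult_single single inv_add distrib_left map_key_plus[OF inj]
        map_key_zero[OF inj])
  show ?thesis
    by (induction p rule: poly_mapping_single_add_induct)
      (simp_all add: single_mult single distrib_right map_key_plus[OF inj]
        map_key_zero[OF inj])
qed

section \<open>Coefficient homomorphisms\<close>

locale comm_ring_hom =
  fixes f :: "'a::comm_ring_1 \<Rightarrow> 'b::comm_ring_1"
  assumes hom_add: "f (x + y) = f x + f y"
    and hom_mult: "f (x * y) = f x * f y"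
    and hom_one: "f 1 = 1"
begin

lemma hom_zero: "f 0 = 0"
  using hom_add[of 0 0] by simp

lemma hom_diff: "f (x - y) = f x - f y"
  using hom_add[of "x - y" y] by simp

lemma hom_sum: "f (sum g A) = (\<Sum>x\<in>A. f (g x))"
  by (induction A rule: infinite_finite_induct) (simp_all add: hom_zero hom_add)

lemma hom_prod: "f (prod g A) = (\<Prod>x\<in>A. f (g x))"
  by (induction A rule: infinite_finite_induct) (simp_all add: hom_one hom_mult)

lemma comm_ring_hom_map_poly: "comm_ring_hom (map_poly f)"
  by unfold_locales
    (auto intro!: poly_eqI
      simp: coeff_map_poly hom_zero hom_add hom_one coeff_mult hom_sum hom_mult coeff_1)

text \<open>
  This is how each substitution acts on \<open>N\<close>, a product of polynomials of this form.
\<close>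

lemma map_poly_prod_linear:
  "map_poly f (\<Prod>x\<in>A. 1 - monom (c x) 1) = (\<Prod>x\<in>A. 1 - monom (f (c x)) 1)"
proof -
  interpret P: comm_ring_hom "map_poly f"
    by (rule comm_ring_hom_map_poly)
  show ?thesis
    by (simp add: P.hom_prod P.hom_diff P.hom_one map_poly_monom hom_zero)
qed

end

lemma comm_ring_hom_map_key:
  fixes f :: "'a::comm_monoid_add \<Rightarrow> 'b::comm_monoid_add"
  assumes "bij f" and "\<And>a b. f (a + b) = f a + f b"
  shows "comm_ring_hom (Poly_Mapping.map_key f :: ('b \<Rightarrow>\<^sub>0 'c::comm_ring_1) \<Rightarrow> _)"
proof
  have inj: "inj f"
    using \<open>bij f\<close> by (rule bij_is_inj)
  obtain e where e: "f e = 0"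
    using \<open>bij f\<close> by (metis bij_pointE)
  have "f 0 = 0"
    using assms(2)[of e 0] e by simp
  then show "Poly_Mapping.map_key f (1 :: 'b \<Rightarrow>\<^sub>0 'c) = 1"
    using map_key_single[OF inj, of 0 "1::'c"] by simp
  fix p q :: "'b \<Rightarrow>\<^sub>0 'c"
  show "Poly_Mapping.map_key f (p + q) = Poly_Mapping.map_key f p + Poly_Mapping.map_key f q"
    by (rule map_key_plus[OF inj])
  show "Poly_Mapping.map_key f (p * q) = Poly_Mapping.map_key f p * Poly_Mapping.map_key f q"
    using assms by (rule map_key_mult)
qed

lemma comm_ring_hom_swap_qt: "comm_ring_hom swap_qt"
  unfolding swap_qt_def by (rule comm_ring_hom_map_key) (auto simp: plus_prod_def)

lemma comm_ring_hom_inv_qt: "comm_ring_hom inv_qt"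
  unfolding inv_qt_def by (rule comm_ring_hom_map_key) (auto simp: bij_uminus)

lemma comm_ring_hom_single_zero:
  "comm_ring_hom (Poly_Mapping.single 0 :: 'b::comm_ring_1 \<Rightarrow> 'a::comm_monoid_add \<Rightarrow>\<^sub>0 'b)"
  by unfold_locales (simp_all add: single_add mult_single)

section \<open>Symmetry of the index set\<close>

lemma uminus_image_I: "uminus ` I m = I m"
proof -
  have "- x \<in> I m" if x: "x \<in> I m" for x
  proof -
    obtain r :: int where r: "x = of_int r - (of_nat m - 1) / 2" "0 \<le> r" "r < int m"
      using x by (auto simp: I_def)
    \<comment> \<open>the reflection \<open>r \<mapsto> m - 1 - r\<close> of the index range\<close>
    have "- x = of_int (int m - 1 - r) - (of_nat m - 1) / 2"
      by (simp add: r field_simps)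
    moreover have "0 \<le> int m - 1 - r" "int m - 1 - r < int m"
      using r by auto
    ultimately show ?thesis
      unfolding I_def by blast
  qed
  then show ?thesis
    by (force simp: image_iff)
qed

lemma card_I: "card (I m) = m"
proof -
  have "inj_on (\<lambda>r. of_int r - (of_nat m - 1) / 2 :: rat) {0..<int m}"
    by (auto simp: inj_on_def)
  then show ?thesis
    by (simp add: I_eq_image card_image)
qed

definition triples :: "nat \<Rightarrow> nat \<Rightarrow> nat \<Rightarrow> (rat \<times> rat \<times> rat) set" where
  "triples k w s = I k \<times> I s \<times> I w"

lemma card_triples: "card (triples k w s) = w * s * k"
  by (simp add: triples_def card_cartesian_product card_I)

lemma bij_betw_uminus_triples: "bij_betw uminus (triples k w s) (triples k w s)"
proof -
  have "uminus ` triples k w s = (uminus ` I k) \<times> (uminus ` I s) \<times> (uminus ` I w)"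
    unfolding triples_def by (force simp: image_iff uminus_prod_def)
  then have "uminus ` triples k w s = triples k w s"
    by (simp add: uminus_image_I triples_def)
  then show ?thesis
    by (simp add: bij_betw_def)
qed

section \<open>The monomials in the factors\<close>

definition factor_mon :: "nat \<Rightarrow> nat \<Rightarrow> rat \<times> rat \<times> rat \<Rightarrow> qt_laurent" where
  "factor_mon w s = (\<lambda>(r, i, j). qt_mon (j + of_nat w * r) (i + of_nat s * r))"

lemma N_eq_prod: "N k w s = (\<Prod>x\<in>triples k w s. 1 - monom (factor_mon w s x) 1)"
  unfolding N_def triples_def factor_mon_def by (intro prod.cong) auto

text \<open>
  The exponents are linear in \<open>x\<close>. Membership in the index set is what makes them
  half-integers; elsewhere the floors in \<open>qt_mon\<close> need not commute with negation.
\<close>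

lemma inv_qt_factor_mon:
  assumes "x \<in> triples k w s"
  shows "inv_qt (factor_mon w s x) = factor_mon w s (- x)"
proof -
  obtain r i j where x: "x = (r, i, j)" "r \<in> I k" "i \<in> I s" "j \<in> I w"
    using assms by (auto simp: triples_def)
  have "inv_qt (qt_mon (j + of_nat w * r) (i + of_nat s * r))
      = qt_mon (- (j + of_nat w * r)) (- (i + of_nat s * r))"
    using x by (intro inv_qt_mon I_exponent_half_integer)
  then show ?thesis
    by (simp add: x(1) factor_mon_def)
qed

lemma factor_mon_mult_inv_qt: "factor_mon w s x * inv_qt (factor_mon w s x) = 1"
proof -
  obtain r i j where x: "x = (r, i, j)"
    by (cases x)
  have inv_single: "inv_qt (Poly_Mapping.single (- a) 1) = Poly_Mapping.single a 1" for a
    unfolding inv_qt_def by (rule map_key_single) simp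
  have "Poly_Mapping.single a 1 * inv_qt (Poly_Mapping.single a 1) = 1" for a
    using inv_single[of "- a"] by (simp add: mult_single)
  then show ?thesis
    by (simp add: x factor_mon_def qt_mon_def)
qed

lemma prod_single_one:
  "(\<Prod>x\<in>A. Poly_Mapping.single (e x) 1)
    = (Poly_Mapping.single (sum e A) 1 :: _ \<Rightarrow>\<^sub>0 'b::comm_semiring_1)"
  by (induction A rule: infinite_finite_induct) (simp_all add: mult_single)

text \<open>
  The product is the monomial whose exponent is the sum of all exponents. Reflecting the index
  set negates that sum, so it equals its own negative in a torsion-free group and vanishes.
  Pairing \<open>x\<close> with \<open>- x\<close> directly would require the fixed point 0 to be handled separately.
\<close>

lemma prod_factor_mon: "(\<Prod>x\<in>triples k w s. factor_mon w s x) = 1"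
proof -
  define e :: "rat \<times> rat \<times> rat \<Rightarrow> int \<times> int" where
    "e = (\<lambda>(r, i, j). (\<lfloor>2 * (j + of_nat w * r)\<rfloor>, \<lfloor>2 * (i + of_nat s * r)\<rfloor>))"
  have factor_mon: "factor_mon w s x = Poly_Mapping.single (e x) 1" for x
    by (simp add: factor_mon_def e_def qt_mon_def split: prod.split)
  \<comment> \<open>read off from the product of the two monomials instead of from the floors\<close>
  have odd: "e (- x) = - e x" if x: "x \<in> triples k w s" for x
  proof -
    have "Poly_Mapping.single (e x + e (- x)) 1 = (Poly_Mapping.single 0 1 :: qt_laurent)"
      using factor_mon_mult_inv_qt[of w s x] inv_qt_factor_mon[OF x]
      by (simp add: factor_mon mult_single)
    then have "e x + e (- x) = 0"
      by (metis lookup_single_eq lookup_single_not_eq zero_neq_one)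
    then show ?thesis
      by (simp add: minus_unique)
  qed
  have "sum e (triples k w s) = (\<Sum>x\<in>triples k w s. e (- x))"
    by (rule sum.reindex_bij_betw[OF bij_betw_uminus_triples, symmetric])
  also have "\<dots> = - sum e (triples k w s)"
    by (simp add: odd sum_negf)
  finally have "sum e (triples k w s) = 0"
    by (simp add: prod_eq_iff)
  then show ?thesis
    by (simp add: factor_mon prod_single_one)
qed

section \<open>The three symmetries\<close>

lemma inv_qt_N: "map_poly inv_qt (N k w s) = N k w s"
proof -
  interpret comm_ring_hom inv_qt
    by (rule comm_ring_hom_inv_qt)
  have "map_poly inv_qt (N k w s) = (\<Prod>x\<in>triples k w s. 1 - monom (factor_mon w s (- x)) 1)"
    by (simp add: N_eq_prod map_poly_prod_linear inv_qt_factor_mon del: One_nat_def cong: prod.cong)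
  also have "\<dots> = N k w s"
    unfolding N_eq_prod by (rule prod.reindex_bij_betw[OF bij_betw_uminus_triples])
  finally show ?thesis .
qed

lemma swap_qt_N: "map_poly swap_qt (N k s w) = N k w s"
proof -
  interpret comm_ring_hom swap_qt
    by (rule comm_ring_hom_swap_qt)
  let ?flip = "\<lambda>(r, i, j). (r, j, i) :: rat \<times> rat \<times> rat"
  have bij: "bij_betw ?flip (triples k w s) (triples k s w)"
    by (rule bij_betw_byWitness[where f' = ?flip]) (auto simp: triples_def)
  have "map_poly swap_qt (N k s w) = (\<Prod>x\<in>triples k s w. 1 - monom (swap_qt (factor_mon s w x)) 1)"
    unfolding N_eq_prod by (rule map_poly_prod_linear)
  also have "\<dots> = (\<Prod>x\<in>triples k w s. 1 - monom (swap_qt (factor_mon s w (?flip x))) 1)"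
    by (rule prod.reindex_bij_betw[OF bij, symmetric])
  also have "\<dots> = N k w s"
    unfolding N_eq_prod by (intro prod.cong) (auto simp: factor_mon_def swap_qt_mon)
  finally show ?thesis .
qed

lemma subst_z_N:
  "subst_z (N k w s) u = (\<Prod>x\<in>triples k w s. 1 - Poly_Mapping.single 0 (factor_mon w s x) * u)"
proof -
  interpret comm_ring_hom "Poly_Mapping.single 0 :: qt_laurent \<Rightarrow> qtz_laurent"
    by (rule comm_ring_hom_single_zero)
  show ?thesis
    by (simp add: subst_z_def N_eq_prod map_poly_prod_linear poly_prod poly_monom del: One_nat_def)
qed

text \<open>
  The power of \<open>- z\<close> in front supplies one \<open>- z\<close> for each factor. It turns the factor at
  \<open>z\<^sup>-\<^sup>1\<close> with index \<open>x\<close> into \<open>c\<^sub>x\<close> times the factor at \<open>z\<close> with index \<open>- x\<close>,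
  because \<open>c\<^sub>x\<close> and the monomial with index \<open>- x\<close> are inverse to each other.
\<close>

lemma subst_z_N_inverse:
  "(- 1) ^ (w * s * k) * z_pow (int (w * s * k)) * subst_z (N k w s) (z_pow (- 1))
    = subst_z (N k w s) (z_pow 1)"
proof -
  let ?C = "Poly_Mapping.single 0 :: qt_laurent \<Rightarrow> qtz_laurent"
  let ?J = "triples k w s" and ?z = "z_pow 1"
  interpret C: comm_ring_hom ?C
    by (rule comm_ring_hom_single_zero)
  have z_pow: "?z ^ n = z_pow (int n)" for n
    by (induction n) (simp_all add: z_pow_def mult_single)
  have z_inverse: "?z * z_pow (- 1) = 1"
    by (simp add: z_pow_def mult_single)
  have factor: "- ?z * (1 - ?C (factor_mon w s x) * z_pow (- 1))
      = ?C (factor_mon w s x) * (1 - ?C (factor_mon w s (- x)) * ?z)" if "x \<in> ?J" for x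
  proof -
    have "?C (factor_mon w s x) * ?C (factor_mon w s (- x)) = 1"
      using factor_mon_mult_inv_qt[of w s x] inv_qt_factor_mon[OF that]
      by (simp add: C.hom_one flip: C.hom_mult)
    moreover have "- z * (1 - c * z') = c * (1 - c' * z)" if "c * c' = 1" "z * z' = 1"
      for c c' z z' :: qtz_laurent
    proof -
      have "- z * (1 - c * z') = - z + c * (z * z')"
        by (simp add: algebra_simps)
      also have "\<dots> = c - (c * c') * z"
        by (simp add: that)
      also have "\<dots> = c * (1 - c' * z)"
        by (simp add: algebra_simps)
      finally show ?thesis .
    qed
    ultimately show ?thesis
      using z_inverse by blast
  qed
  have "(- 1) ^ (w * s * k) * z_pow (int (w * s * k)) = (- ?z) ^ card ?J"
    by (simp only: card_triples z_pow power_minus[of ?z])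
  then have "(- 1) ^ (w * s * k) * z_pow (int (w * s * k)) * subst_z (N k w s) (z_pow (- 1))
      = (\<Prod>x\<in>?J. - ?z * (1 - ?C (factor_mon w s x) * z_pow (- 1)))"
    by (simp only: subst_z_N prod.distrib prod_constant)
  also have "\<dots> = (\<Prod>x\<in>?J. ?C (factor_mon w s x) * (1 - ?C (factor_mon w s (- x)) * ?z))"
    using factor by (rule prod.cong[OF refl])
  also have "\<dots> = ?C (\<Prod>x\<in>?J. factor_mon w s x) * (\<Prod>x\<in>?J. 1 - ?C (factor_mon w s (- x)) * ?z)"
    by (simp only: C.hom_prod prod.distrib)
  also have "(\<Prod>x\<in>?J. 1 - ?C (factor_mon w s (- x)) * ?z) = subst_z (N k w s) ?z"
    unfolding subst_z_N by (rule prod.reindex_bij_betw[OF bij_betw_uminus_triples])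
  finally show ?thesis
    by (simp add: prod_factor_mon C.hom_one)
qed

theorem proposition6p4:
  fixes k w s :: nat
  assumes "k > 0" and "w > 0" and "s > 0"
  shows "N k w s = map_poly swap_qt (N k s w)
    \<and> subst_z (N k w s) (z_pow 1)
        = (- 1) ^ (w * s * k) * z_pow (int (w * s * k)) * subst_z (N k w s) (z_pow (- 1))
    \<and> map_poly inv_qt (N k w s) = N k w s"
  by (simp only: swap_qt_N subst_z_N_inverse inv_qt_N simp_thms)

end
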